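(* Let $\lambda$ be a nonzero real number and let $Y$ be a random variable whose moment generating function $E[e^{Yt}]$ exists for $|t|<r$ for some $r>0$. For every integer $m\ge 1$, $$\mathrm{Bel}_{m,\lambda}^{(1,Y)}(x)=\sum_{n=1}^{m}(1)_{n,\lambda}{m \brace n}_{Y,\lambda}x^{n}.$$ In particular, $\mathrm{Bel}_{m,\lambda}^{(1,Y)}=\sum_{n=1}^{m}(1)_{n,\lambda}{m \brace n}_{Y,\lambda}$.
   Context: Degenerate falling factorial: $(x)_{0,\lambda}=1$, $(x)_{n,\lambda}=x(x-\lambda)(x-2\lambda)\cdots(x-(n-1)\lambda)$ for $n\ge1$. Degenerate exponential: $e_\lambda^x(t)=(1+\lambda t)^{x/\lambda}=\sum_{n\ge0}(x)_{n,\lambda}\frac{t^n}{n!}$, $e_\lambda(t)=e_\lambda^1(t)$. For $k\in\mathbb{Z}$, the degenerate polyexponential function is $\mathrm{Ei}_{k,\lambda}(x)=\sum_{n=1}^{\infty}\frac{(1)_{n,\lambda}}{(n-1)!\,n^{k}}x^{n}$. The probabilistic degenerate poly-Bell polynomials associated with $Y$ are defined by the power series identity in $t$ $$\mathrm{Ei}_{k,\lambda}\big(x(E[e_\lambda^Y(t)]-1)\big)=\sum_{n=1}^{\infty}\mathrm{Bel}_{n,\lambda}^{(k,Y)}(x)\frac{t^n}{n!},\qquad \mathrm{Bel}_{0,\lambda}^{(k,Y)}(x)=1,$$ and $\mathrm{Bel}_{n,\lambda}^{(k,Y)}=\mathrm{Bel}_{n,\lambda}^{(k,Y)}(1)$.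 The probabilistic degenerate Stirling numbers of the second kind associated with $Y$ are defined by $\frac{1}{k!}\big(E[e_\lambda^Y(t)]-1\big)^k=\sum_{n\ge k}{n \brace k}_{Y,\lambda}\frac{t^n}{n!}$ for $k\ge0$. *)

theory Defs
  imports "HOL-Probability.Probability"
begin

definition deg_ffact :: "real \<Rightarrow> real \<Rightarrow> nat \<Rightarrow> real" where
  "deg_ffact lam x n = (\<Prod>i<n. x - real i * lam)"

text \<open>The degenerate exponential, as a function of \<open>t\<close> with \<open>1 + lam * t > 0\<close>
  (the only range in which it is used, since all expansions below are taken at \<open>t = 0\<close>).\<close>

definition deg_exp :: "real \<Rightarrow> real \<Rightarrow> real \<Rightarrow> real" where
  "deg_exp lam x t = (1 + lam * t) powr (x / lam)"

lemma deg_exp_sums: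
  fixes lam x t :: real
  assumes "lam \<noteq> 0" and "\<bar>lam * t\<bar> < 1"
  shows "(\<lambda>n. deg_ffact lam x n * t ^ n / fact n) sums deg_exp lam x t"
proof -
  have *: "((x / lam) gchoose n) * (lam * t) ^ n = deg_ffact lam x n * t ^ n / fact n" for n
  proof -
    have "(\<Prod>i<n. x / lam - real i) * lam ^ n = (\<Prod>i<n. (x / lam - real i) * lam)"
      by (simp add: prod.distrib)
    also have "\<dots> = deg_ffact lam x n"
      unfolding deg_ffact_def using assms(1) by (intro prod.cong) (auto simp: field_simps)
    finally show ?thesis
      by (simp add: gbinomial_prod_rev atLeast0LessThan power_mult_distrib)
  qed
  show ?thesis
    using gen_binomial_real[OF assms(2), of "x / lam"] unfolding * deg_exp_def .
qed

definition deg_polyexp :: "int \<Rightarrow> real \<Rightarrow> real \<Rightarrow> real" where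
  "deg_polyexp k lam x =
     (\<Sum>n. if n = 0 then 0 else deg_ffact lam 1 n / (fact (n - 1) * real n powi k) * x ^ n)"

definition expect_deg_exp :: "'a measure \<Rightarrow> ('a \<Rightarrow> real) \<Rightarrow> real \<Rightarrow> real \<Rightarrow> real" where
  "expect_deg_exp M Y lam t = (LINT \<omega>|M. deg_exp lam (Y \<omega>) t)"

text \<open>The two families below are the coefficient sequences determined by their generating
  functions. The identities are between genuine functions of \<open>t\<close> near \<open>0\<close> and convergent power
  series, and such an expansion is unique.\<close>

text \<open>\<open>prob_deg_bell M Y k lam x n\<close> is the value at \<open>x\<close> of the \<open>n\<close>-th probabilistic degenerate
  poly-Bell polynomial of index \<open>k\<close>. The value \<open>1\<close> at \<open>n = 0\<close> is a convention: the series starts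
  at \<open>n = 1\<close>.\<close>

definition prob_deg_bell ::
  "'a measure \<Rightarrow> ('a \<Rightarrow> real) \<Rightarrow> int \<Rightarrow> real \<Rightarrow> real \<Rightarrow> nat \<Rightarrow> real" where
  "prob_deg_bell M Y k lam x =
     (THE B. B 0 = 1 \<and>
        (\<lambda>t. deg_polyexp k lam (x * (expect_deg_exp M Y lam t - 1)))
          has_fps_expansion Abs_fps (\<lambda>n. if n = 0 then 0 else B n / fact n))"

definition prob_deg_bell_number ::
  "'a measure \<Rightarrow> ('a \<Rightarrow> real) \<Rightarrow> int \<Rightarrow> real \<Rightarrow> nat \<Rightarrow> real" where
  "prob_deg_bell_number M Y k lam n = prob_deg_bell M Y k lam 1 n"

text \<open>\<open>prob_deg_Stirling M Y lam n k\<close> has \<open>n\<close> as upper and \<open>k\<close> as lower index; it is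
  \<open>0\<close> for \<open>n < k\<close>, where the series has no term.\<close>

definition prob_deg_Stirling ::
  "'a measure \<Rightarrow> ('a \<Rightarrow> real) \<Rightarrow> real \<Rightarrow> nat \<Rightarrow> nat \<Rightarrow> real" where
  "prob_deg_Stirling M Y lam n k =
     (THE S. (\<forall>j<k. S j = 0) \<and>
        (\<lambda>t. 1 / fact k * (expect_deg_exp M Y lam t - 1) ^ k)
          has_fps_expansion Abs_fps (\<lambda>j. S j / fact j)) n"

end

theory Submission
  imports Defs "HOL-Complex_Analysis.Laurent_Convergence"
begin

text \<open>For small \<open>t\<close>, dominated convergence gives
  \<open>E[e\<^sub>\<lambda>\<^sup>Y(t)] = \<Sum>n. E[(Y)\<^sub>n\<^sub>,\<^sub>\<lambda>] t\<^sup>n / n!\<close>: replacing \<open>Y\<close>, \<open>\<lambda>\<close>, \<open>t\<close> by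
  \<open>\<bar>Y\<bar>\<close>, \<open>-\<bar>\<lambda>\<bar>\<close>, \<open>\<bar>t\<bar>\<close> yields a series of nonnegative terms that majorises the original one and
  sums to \<open>exp (s \<bar>Y\<bar>)\<close> for a small \<open>s\<close>. So all the generating functions are genuine power series.
  The \<open>n\<close>-th coefficient of \<open>Ei\<^sub>k\<^sub>,\<^sub>\<lambda>\<close> is \<open>(1)\<^sub>n\<^sub>,\<^sub>\<lambda> n\<^bsup>1-k\<^esup> / n!\<close>, so comparing
  coefficients in its composition with \<open>x (E[e\<^sub>\<lambda>\<^sup>Y(t)] - 1)\<close> expresses the poly-Bell polynomials of
  every index \<open>k\<close> through the Stirling numbers; \<open>k = 1\<close> removes the factor \<open>n\<^bsup>1-k\<^esup>\<close>.\<close>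

section \<open>Power series expansions and termwise integration\<close>

lemma has_fps_expansion_imp_fps_nth_eq_higher_deriv:
  fixes F :: "'a::{banach,real_normed_field} fps"
  assumes "f has_fps_expansion F"
  shows "fps_nth F n = (deriv ^^ n) f 0 / fact n"
  using assms
proof (induction n arbitrary: f F)
  case 0
  then show ?case
    by (simp add: has_fps_expansion_imp_0_eq_fps_nth_0)
next
  case (Suc n)
  have "of_nat (Suc n) * fps_nth F (Suc n) = fps_nth (fps_deriv F) n"
    by simp
  also have "\<dots> = (deriv ^^ n) (deriv f) 0 / fact n"
    by (intro Suc.IH has_fps_expansion_deriv Suc.prems)
  finally show ?case
    by (simp add: funpow_swap1 field_simps del: of_nat_Suc)
qed

lemma has_fps_expansion_iff_eq:
  fixes F :: "'a::{banach,real_normed_field} fps"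
  assumes "f has_fps_expansion F"
  shows "f has_fps_expansion G \<longleftrightarrow> G = F"
proof
  assume "f has_fps_expansion G"
  with assms show "G = F"
    by (simp add: fps_eq_iff has_fps_expansion_imp_fps_nth_eq_higher_deriv)
qed (use assms in simp)

lemma eventually_norm_less_ereal:
  assumes "R > 0"
  shows "\<forall>\<^sub>F z in nhds (0::'a::real_normed_vector). ereal (norm z) < R"
  using eventually_nhds_in_open[of "eball (0::'a) R" 0] assms by (simp add: zero_ereal_def)

definition norm_fps :: "'a::real_normed_vector fps \<Rightarrow> real fps" where
  "norm_fps F = Abs_fps (\<lambda>n. norm (fps_nth F n))"

lemma fps_nth_norm_fps [simp]: "fps_nth (norm_fps F) n = norm (fps_nth F n)"
  by (simp add: norm_fps_def)

lemma fps_conv_radius_norm_fps [simp]: "fps_conv_radius (norm_fps F) = fps_conv_radius F"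
  by (simp add: norm_fps_def)

lemma norm_fps_nth_power_le:
  fixes F :: "'a::real_normed_algebra_1 fps"
  shows "norm (fps_nth (F ^ n) k) \<le> fps_nth (norm_fps F ^ n) k"
proof (induction n arbitrary: k)
  case 0
  show ?case by simp
next
  case (Suc n)
  have "norm (fps_nth F i * fps_nth (F ^ n) (k - i)) \<le>
      norm (fps_nth F i) * fps_nth (norm_fps F ^ n) (k - i)" for i
    by (rule order_trans[OF norm_mult_ineq mult_left_mono[OF Suc.IH norm_ge_zero]])
  then show ?case
    by (auto simp: fps_mult_nth intro: sum_norm_le)
qed

lemma norm_eval_fps_le:
  assumes "norm z < fps_conv_radius F"
  shows "norm (eval_fps F z) \<le> eval_fps (norm_fps F) (norm z)"
  using summable_norm[OF norm_summable_fps[OF assms]]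
  by (simp add: eval_fps_def norm_mult norm_power)

lemma has_sum_eval_fps:
  assumes "norm z < fps_conv_radius F"
  shows "((\<lambda>n. fps_nth F n * z ^ n) has_sum eval_fps F z) UNIV"
  by (intro norm_summable_imp_has_sum norm_summable_fps sums_eval_fps assms)

lemma has_sum_eval_fps_power:
  fixes F :: "'a::{banach,real_normed_field} fps"
  assumes "norm z < fps_conv_radius F"
  shows "((\<lambda>k. fps_nth (F ^ n) k * z ^ k) has_sum eval_fps F z ^ n) UNIV"
  using has_sum_eval_fps[of z "F ^ n"] less_le_trans[OF assms fps_conv_radius_power]
  by (simp add: eval_fps_power[OF assms])

lemma summable_on_fps_compose:
  fixes F G :: "'a::{banach,real_normed_field} fps"
  assumes z: "norm z < fps_conv_radius G"
    and Gz: "eval_fps (norm_fps G) (norm z) < fps_conv_radius F"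
  shows "(\<lambda>(n, k). fps_nth F n * (fps_nth (G ^ n) k * z ^ k)) summable_on UNIV \<times> UNIV"
proof -
  define r where "r = eval_fps (norm_fps G) (norm z)"
  define h where "h n k = norm (fps_nth F n) * (fps_nth (norm_fps G ^ n) k * norm z ^ k)" for n k
  have "r \<ge> 0"
    using order_trans[OF norm_ge_zero norm_eval_fps_le[OF z]] by (simp add: r_def)
  have term_le: "norm (fps_nth F n * (fps_nth (G ^ n) k * z ^ k)) \<le> h n k" for n k
    by (simp add: h_def norm_mult norm_power mult_left_mono mult_right_mono norm_fps_nth_power_le)
  have h_nonneg: "h n k \<ge> 0" for n k
    using order_trans[OF norm_ge_zero term_le] .
  have row: "(h n has_sum norm (fps_nth F n) * r ^ n) UNIV" for n
    unfolding h_def[abs_def] r_def using z by (intro has_sum_cmult_right has_sum_eval_fps_power) simp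
  have "(\<lambda>n. fps_nth (norm_fps F) n * r ^ n) summable_on UNIV"
    using has_sum_eval_fps[of r "norm_fps F"] \<open>r \<ge> 0\<close> Gz
    by (intro has_sum_imp_summable) (simp_all add: r_def)
  then have "(\<lambda>(n, k). h n k) summable_on UNIV \<times> UNIV"
    using row h_nonneg by (intro summable_on_SigmaI[where g = "\<lambda>n. norm (fps_nth F n) * r ^ n"]) auto
  then show ?thesis
    by (rule Infinite_Sum.abs_summable_summable[OF Infinite_Sum.abs_summable_on_comparison_test'])
      (auto simp: term_le)
qed

lemma sums_eval_fps_compose:
  fixes F G :: "'a::{banach,real_normed_field} fps"
  assumes z: "norm z < fps_conv_radius G"
    and Gz: "eval_fps (norm_fps G) (norm z) < fps_conv_radius F"
    and G0: "fps_nth G 0 = 0"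
  shows "(\<lambda>k. fps_nth (F oo G) k * z ^ k) sums eval_fps F (eval_fps G z)"
proof -
  define a where "a n k = fps_nth F n * (fps_nth (G ^ n) k * z ^ k)" for n k
  have a_summable: "(\<lambda>(n, k). a n k) summable_on UNIV \<times> UNIV"
    unfolding a_def by (rule summable_on_fps_compose[OF z Gz])
  then have a_summable_swap: "(\<lambda>(k, n). a n k) summable_on UNIV \<times> UNIV"
    by (subst (asm) summable_on_swap) simp
  have row: "infsum (a n) UNIV = fps_nth F n * eval_fps G z ^ n" for n
    unfolding a_def[abs_def] by (intro infsumI has_sum_cmult_right has_sum_eval_fps_power z)
  have column: "infsum (\<lambda>n. a n k) UNIV = fps_nth (F oo G) k * z ^ k" for k
  proof -
    have "a n k = 0" if "n > k" for n
      using startsby_zero_power_prefix[OF G0, of n] that by (simp add: a_def)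
    then have "infsum (\<lambda>n. a n k) UNIV = infsum (\<lambda>n. a n k) {0..k}"
      by (intro infsum_cong_neutral) auto
    also have "\<dots> = fps_nth (F oo G) k * z ^ k"
      by (simp add: a_def fps_compose_nth sum_distrib_right mult.assoc)
    finally show ?thesis .
  qed
  have "ereal (norm (eval_fps G z)) < fps_conv_radius F"
    using norm_eval_fps_le[OF z] Gz by (meson ereal_less_eq(3) le_less_trans)
  then have "eval_fps F (eval_fps G z) = (\<Sum>\<^sub>\<infinity>n. \<Sum>\<^sub>\<infinity>k. a n k)"
    unfolding row by (intro infsumI[symmetric] has_sum_eval_fps)
  also have "\<dots> = (\<Sum>\<^sub>\<infinity>k. \<Sum>\<^sub>\<infinity>n. a n k)"
    by (rule infsum_swap_banach[OF a_summable])
  finally have "((\<lambda>k. \<Sum>\<^sub>\<infinity>n. a n k) has_sum eval_fps F (eval_fps G z)) UNIV"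
    using summable_on_Sigma_banach[OF a_summable_swap] by simp
  then show ?thesis
    unfolding column by (rule has_sum_imp_sums)
qed

lemma has_fps_expansion_fps_compose:
  fixes f g :: "'a::{banach,real_normed_field} \<Rightarrow> 'a"
  assumes F: "f has_fps_expansion F" and G: "g has_fps_expansion G" and G0: "fps_nth G 0 = 0"
  shows "(\<lambda>z. f (g z)) has_fps_expansion (F oo G)"
proof (rule has_fps_expansionI)
  have F_radius: "fps_conv_radius F > 0" and G_radius: "fps_conv_radius G > 0"
    and f_eq: "\<forall>\<^sub>F y in nhds 0. eval_fps F y = f y" and g_eq: "\<forall>\<^sub>F z in nhds 0. eval_fps G z = g z"
    using F G by (auto simp: has_fps_expansion_def)
  have "isCont (eval_fps (norm_fps G)) 0"
    using G_radius by (intro has_fps_expansion_imp_continuous[OF eval_fps_has_fps_expansion]) simp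
  then have "isCont (\<lambda>z::'a. eval_fps (norm_fps G) (norm z)) 0"
    by (intro isCont_o2[OF isCont_norm[OF continuous_ident]]) simp
  then have "filterlim (\<lambda>z::'a. eval_fps (norm_fps G) (norm z)) (nhds 0) (nhds 0)"
    using G0 by (simp add: continuous_at tendsto_nhds_iff eval_fps_at_0)
  then have majorant: "\<forall>\<^sub>F z::'a in nhds 0.
      ereal (norm (eval_fps (norm_fps G) (norm z))) < fps_conv_radius F"
    by (rule eventually_compose_filterlim[OF eventually_norm_less_ereal[OF F_radius]])
  have "filterlim g (nhds 0) (nhds 0)"
    using has_fps_expansion_imp_continuous[OF G, of UNIV]
      has_fps_expansion_imp_0_eq_fps_nth_0[OF G] G0
    by (simp add: continuous_at tendsto_nhds_iff)
  then have "\<forall>\<^sub>F z in nhds 0. eval_fps F (g z) = f (g z)"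
    by (rule eventually_compose_filterlim[OF f_eq])
  then show "\<forall>\<^sub>F z in nhds 0. (\<lambda>k. fps_nth (F oo G) k * z ^ k) sums f (g z)"
    using g_eq majorant eventually_norm_less_ereal[OF G_radius]
  proof eventually_elim
    case (elim z)
    have "ereal (eval_fps (norm_fps G) (norm z)) < fps_conv_radius F"
      using elim(3) by (rule le_less_trans[rotated]) simp
    then show ?case
      using sums_eval_fps_compose[OF elim(4) _ G0] elim(1,2) by metis
  qed
qed

lemma conv_radius_power_int_mult:
  fixes f :: "nat \<Rightarrow> 'a::{banach,real_normed_field}"
  shows "conv_radius (\<lambda>n. of_nat n powi j * f n) = conv_radius f"
proof -
  have root_powi: "root n (x powi j) = root n x powi j" if "n > 0" "x \<ge> 0" for n :: nat and x :: real
    using that by (simp add: power_int_def real_root_power real_root_inverse)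
  have "(\<lambda>n. root n (real n) powi j) \<longlonglongrightarrow> 1 powi j"
    by (intro tendsto_power_int LIMSEQ_root) simp
  then have root_lim: "(\<lambda>n. ereal (root n (real n) powi j)) \<longlonglongrightarrow> 1"
    by (simp add: one_ereal_def)
  have "limsup (\<lambda>n. ereal (root n (norm (of_nat n powi j * f n)))) =
      limsup (\<lambda>n. ereal (root n (real n) powi j) * ereal (root n (norm (f n))))"
    by (intro Limsup_eq eventually_mono[OF eventually_gt_at_top[of 0]])
      (simp add: norm_mult norm_power_int real_root_mult root_powi)
  also have "\<dots> = limsup (\<lambda>n. ereal (root n (norm (f n))))"
    using ereal_limsup_lim_mult[OF root_lim] by (simp del: times_ereal.simps)
  finally show ?thesis
    by (simp add: conv_radius_def)
qed

lemma eventually_abs_mult_less_1: "\<forall>\<^sub>F t in nhds 0. \<bar>c * t\<bar> < (1::real)"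
proof -
  have "((\<lambda>t. \<bar>c * t\<bar>) \<longlongrightarrow> \<bar>c * 0\<bar>) (nhds 0)"
    by (intro tendsto_intros filterlim_ident)
  then show ?thesis
    by (rule order_tendstoD) simp
qed

lemma integral_sums_dominated:
  fixes f :: "nat \<Rightarrow> 'a \<Rightarrow> 'b::{banach,second_countable_topology}"
  assumes f_measurable [measurable]: "\<And>n. f n \<in> borel_measurable M"
    and f_sums: "\<And>x. x \<in> space M \<Longrightarrow> (\<lambda>n. f n x) sums s x"
    and f_le: "\<And>n x. x \<in> space M \<Longrightarrow> norm (f n x) \<le> b n x"
    and b_sums: "\<And>x. x \<in> space M \<Longrightarrow> (\<lambda>n. b n x) sums w x"
    and w: "integrable M w"
  shows "(\<lambda>n. integral\<^sup>L M (f n)) sums integral\<^sup>L M s"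
proof -
  have s_measurable [measurable]: "s \<in> borel_measurable M"
  proof (rule borel_measurable_LIMSEQ_metric)
    show "(\<lambda>x. \<Sum>n<N. f n x) \<in> borel_measurable M" for N
      by measurable
    show "(\<lambda>N. \<Sum>n<N. f n x) \<longlonglongrightarrow> s x" if "x \<in> space M" for x
      using f_sums[OF that] by (simp add: sums_def)
  qed
  have b_nonneg: "b n x \<ge> 0" if "x \<in> space M" for n x
    using norm_ge_zero f_le[OF that] by (rule order_trans)
  have b_sum_le: "sum (\<lambda>n. b n x) A \<le> w x" if "x \<in> space M" "finite A" for x A
    using sum_le_suminf[of "\<lambda>n. b n x" A] b_sums[OF that(1)] b_nonneg[OF that(1)] that(2)
    by (simp add: sums_iff)
  have "integrable M (f n)" for n
  proof (rule Bochner_Integration.integrable_bound[OF w])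
    show "AE x in M. norm (f n x) \<le> norm (w x)"
    proof (rule AE_I2)
      fix x assume "x \<in> space M"
      then have "norm (f n x) \<le> w x"
        using f_le[of x n] b_sum_le[of x "{n}"] by simp
      then show "norm (f n x) \<le> norm (w x)" by simp
    qed
  qed simp
  moreover have "(\<lambda>N. \<integral>x. (\<Sum>n<N. f n x) \<partial>M) \<longlonglongrightarrow> integral\<^sup>L M s"
  proof (rule integral_dominated_convergence[where w = w])
    show "AE x in M. norm (\<Sum>n<N. f n x) \<le> w x" for N
      by (intro AE_I2) (force intro: order_trans[OF sum_norm_le[OF f_le] b_sum_le])
    show "AE x in M. (\<lambda>N. \<Sum>n<N. f n x) \<longlonglongrightarrow> s x"
      using f_sums by (auto simp: sums_def)
  qed (use w in auto)
  ultimately show ?thesis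
    by (simp add: sums_def)
qed

section \<open>The expected degenerate exponential\<close>

lemma deg_exp_has_fps_expansion:
  assumes "lam \<noteq> 0"
  shows "deg_exp lam x has_fps_expansion Abs_fps (\<lambda>n. deg_ffact lam x n / fact n)"
proof (rule has_fps_expansionI)
  show "\<forall>\<^sub>F t in nhds 0. (\<lambda>n. fps_nth (Abs_fps (\<lambda>n. deg_ffact lam x n / fact n)) n * t ^ n)
      sums deg_exp lam x t"
    using eventually_abs_mult_less_1[of lam]
    by eventually_elim (use deg_exp_sums[OF assms] in simp)
qed

lemma deg_exp_eq_exp:
  assumes "\<bar>lam * t\<bar> < 1"
  shows "deg_exp lam x t = exp (x * (ln (1 + lam * t) / lam))"
  using assms by (simp add: deg_exp_def powr_def)

lemma abs_deg_ffact_le: "\<bar>deg_ffact lam x n\<bar> \<le> deg_ffact (- \<bar>lam\<bar>) \<bar>x\<bar> n"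
  unfolding deg_ffact_def abs_prod
proof (intro prod_mono conjI)
  fix i
  have "\<bar>x - real i * lam\<bar> \<le> \<bar>x\<bar> + \<bar>real i * lam\<bar>"
    by (rule abs_triangle_ineq4)
  then show "\<bar>x - real i * lam\<bar> \<le> \<bar>x\<bar> - real i * - \<bar>lam\<bar>"
    by (simp add: abs_mult)
qed auto

lemma measurable_deg_ffact [measurable]:
  "Y \<in> borel_measurable M \<Longrightarrow> (\<lambda>\<omega>. deg_ffact lam (Y \<omega>) n) \<in> borel_measurable M"
  unfolding deg_ffact_def by (intro borel_measurable_prod borel_measurable_diff) auto

lemma expect_deg_exp_sums:
  assumes [measurable]: "Y \<in> borel_measurable M"
    and lam: "lam \<noteq> 0" and t: "\<bar>lam * t\<bar> < 1"
    and majorant: "integrable M (\<lambda>\<omega>. deg_exp (- \<bar>lam\<bar>) \<bar>Y \<omega>\<bar> \<bar>t\<bar>)"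
  shows "(\<lambda>n. (LINT \<omega>|M. deg_ffact lam (Y \<omega>) n) / fact n * t ^ n) sums expect_deg_exp M Y lam t"
proof -
  have "(\<lambda>n. LINT \<omega>|M. deg_ffact lam (Y \<omega>) n * t ^ n / fact n) sums expect_deg_exp M Y lam t"
    unfolding expect_deg_exp_def
  proof (rule integral_sums_dominated)
    show "(\<lambda>n. deg_ffact lam (Y \<omega>) n * t ^ n / fact n) sums deg_exp lam (Y \<omega>) t" for \<omega>
      by (rule deg_exp_sums[OF lam t])
    show "(\<lambda>n. deg_ffact (- \<bar>lam\<bar>) \<bar>Y \<omega>\<bar> n * \<bar>t\<bar> ^ n / fact n) sums
        deg_exp (- \<bar>lam\<bar>) \<bar>Y \<omega>\<bar> \<bar>t\<bar>" for \<omega>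
      using lam t by (intro deg_exp_sums) (auto simp: abs_mult)
    show "norm (deg_ffact lam (Y \<omega>) n * t ^ n / fact n) \<le>
        deg_ffact (- \<bar>lam\<bar>) \<bar>Y \<omega>\<bar> n * \<bar>t\<bar> ^ n / fact n" for n \<omega>
      by (simp add: abs_mult power_abs divide_right_mono mult_right_mono abs_deg_ffact_le)
  qed (use majorant in auto)
  then show ?thesis
    by simp
qed

lemma integrable_exp_abs_mult:
  fixes Y :: "'a \<Rightarrow> real"
  assumes [measurable]: "Y \<in> borel_measurable M"
    and "integrable M (\<lambda>\<omega>. exp (Y \<omega> * s))" "integrable M (\<lambda>\<omega>. exp (Y \<omega> * - s))"
  shows "integrable M (\<lambda>\<omega>. exp (\<bar>Y \<omega>\<bar> * s))"
proof (rule Bochner_Integration.integrable_bound)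
  show "integrable M (\<lambda>\<omega>. exp (Y \<omega> * s) + exp (Y \<omega> * - s))"
    using assms by (intro Bochner_Integration.integrable_add)
  show "AE \<omega> in M. norm (exp (\<bar>Y \<omega>\<bar> * s)) \<le> norm (exp (Y \<omega> * s) + exp (Y \<omega> * - s))"
    by (intro AE_I2) (auto simp: abs_if[of "Y _"] add_nonneg_nonneg)
qed simp

lemma eventually_integrable_deg_exp_abs:
  assumes Y: "Y \<in> borel_measurable M"
    and mgf: "\<exists>r>0. \<forall>t. \<bar>t\<bar> < r \<longrightarrow> integrable M (\<lambda>\<omega>. exp (Y \<omega> * t))"
  shows "\<forall>\<^sub>F t in nhds 0. integrable M (\<lambda>\<omega>. deg_exp lam \<bar>Y \<omega>\<bar> \<bar>t\<bar>)"
proof -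
  obtain r where "r > 0" and r: "\<And>t. \<bar>t\<bar> < r \<Longrightarrow> integrable M (\<lambda>\<omega>. exp (Y \<omega> * t))"
    using mgf by blast
  define s where "s t = ln (1 + lam * \<bar>t\<bar>) / lam" for t
  have "isCont (\<lambda>t. \<bar>s t\<bar>) 0"
    unfolding s_def divide_inverse by (intro continuous_intros) simp
  then have "((\<lambda>t. \<bar>s t\<bar>) \<longlongrightarrow> 0) (nhds 0)"
    by (simp add: continuous_at tendsto_nhds_iff s_def)
  then have "\<forall>\<^sub>F t in nhds 0. \<bar>s t\<bar> < r"
    by (rule order_tendstoD) (rule \<open>r > 0\<close>)
  then show ?thesis
    using eventually_abs_mult_less_1[of lam]
  proof eventually_elim
    case (elim t)
    have "integrable M (\<lambda>\<omega>. exp (\<bar>Y \<omega>\<bar> * s t))"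
      using elim(1) by (intro integrable_exp_abs_mult Y r) auto
    then show ?case
      using elim(2) by (simp add: deg_exp_eq_exp abs_mult s_def)
  qed
qed

definition expect_deg_exp_fps :: "'a measure \<Rightarrow> ('a \<Rightarrow> real) \<Rightarrow> real \<Rightarrow> real fps" where
  "expect_deg_exp_fps M Y lam = Abs_fps (\<lambda>n. (LINT \<omega>|M. deg_ffact lam (Y \<omega>) n) / fact n)"

lemma expect_deg_exp_has_fps_expansion:
  assumes Y: "Y \<in> borel_measurable M"
    and mgf: "\<exists>r>0. \<forall>t. \<bar>t\<bar> < r \<longrightarrow> integrable M (\<lambda>\<omega>. exp (Y \<omega> * t))"
    and lam: "lam \<noteq> 0"
  shows "expect_deg_exp M Y lam has_fps_expansion expect_deg_exp_fps M Y lam"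
proof (rule has_fps_expansionI)
  show "\<forall>\<^sub>F t in nhds 0. (\<lambda>n. fps_nth (expect_deg_exp_fps M Y lam) n * t ^ n)
      sums expect_deg_exp M Y lam t"
    using eventually_abs_mult_less_1[of lam]
      eventually_integrable_deg_exp_abs[OF Y mgf, of "- \<bar>lam\<bar>"]
    by eventually_elim (use expect_deg_exp_sums[OF Y lam] in \<open>simp add: expect_deg_exp_fps_def\<close>)
qed

lemma (in prob_space) expect_deg_exp_fps_nth_0: "fps_nth (expect_deg_exp_fps M Y lam) 0 = 1"
  by (simp add: expect_deg_exp_fps_def deg_ffact_def prob_space)

section \<open>Coefficients of the generating functions\<close>

definition deg_polyexp_fps :: "int \<Rightarrow> real \<Rightarrow> real fps" where
  "deg_polyexp_fps k lam =
     Abs_fps (\<lambda>n. if n = 0 then 0 else deg_ffact lam 1 n / (fact (n - 1) * real n powi k))"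

lemma deg_polyexp_fps_nth:
  assumes "n > 0"
  shows "fps_nth (deg_polyexp_fps k lam) n = real n powi (1 - k) * (deg_ffact lam 1 n / fact n)"
  using assms by (simp add: deg_polyexp_fps_def power_int_diff fact_reduce[of n])

lemma deg_polyexp_has_fps_expansion:
  assumes lam: "lam \<noteq> 0"
  shows "deg_polyexp k lam has_fps_expansion deg_polyexp_fps k lam"
proof -
  have "fps_conv_radius (deg_polyexp_fps k lam) =
      conv_radius (\<lambda>n. real n powi (1 - k) * (deg_ffact lam 1 n / fact n))"
    unfolding fps_conv_radius_def
    by (intro conv_radius_cong' eventually_mono[OF eventually_gt_at_top[of 0]] deg_polyexp_fps_nth)
  also have "\<dots> = fps_conv_radius (Abs_fps (\<lambda>n. deg_ffact lam 1 n / fact n))"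
    by (simp add: fps_conv_radius_def conv_radius_power_int_mult del: times_divide_eq_right)
  also have "\<dots> > 0"
    using deg_exp_has_fps_expansion[OF lam] by (simp add: has_fps_expansion_def)
  finally have "eval_fps (deg_polyexp_fps k lam) has_fps_expansion deg_polyexp_fps k lam"
    by (rule eval_fps_has_fps_expansion)
  also have "eval_fps (deg_polyexp_fps k lam) = deg_polyexp k lam"
    by (rule ext) (auto simp: eval_fps_def deg_polyexp_def deg_polyexp_fps_def intro!: suminf_cong)
  finally show ?thesis .
qed

lemma prob_deg_Stirling_eq_fps_nth:
  assumes F: "expect_deg_exp M Y lam has_fps_expansion F" and F0: "fps_nth F 0 = 1"
  shows "prob_deg_Stirling M Y lam n k = fact n / fact k * fps_nth ((F - 1) ^ k) n"
proof -
  define H where "H = fps_const (1 / fact k) * (F - 1) ^ k"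
  have expansion: "(\<lambda>t. 1 / fact k * (expect_deg_exp M Y lam t - 1) ^ k) has_fps_expansion H"
    unfolding H_def by (intro fps_expansion_intros F)
  have "fps_nth H j = 0" if "j < k" for j
    using startsby_zero_power_prefix[of "F - 1" k] F0 that by (simp add: H_def)
  then have "(\<forall>j<k. S j = 0) \<and> Abs_fps (\<lambda>j. S j / fact j) = H \<longleftrightarrow>
      S = (\<lambda>j. fact j * fps_nth H j)" for S
    by (auto simp: fps_eq_iff fun_eq_iff field_simps)
  then show ?thesis
    unfolding prob_deg_Stirling_def has_fps_expansion_iff_eq[OF expansion] by (simp add: H_def)
qed

lemma prob_deg_bell_eq_fps_nth:
  assumes F: "expect_deg_exp M Y lam has_fps_expansion F" and F0: "fps_nth F 0 = 1"
    and lam: "lam \<noteq> 0" and m: "m > 0"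
  shows "prob_deg_bell M Y k lam x m =
    fact m * fps_nth (deg_polyexp_fps k lam oo (fps_const x * (F - 1))) m"
proof -
  define H where "H = deg_polyexp_fps k lam oo (fps_const x * (F - 1))"
  have expansion: "(\<lambda>t. deg_polyexp k lam (x * (expect_deg_exp M Y lam t - 1))) has_fps_expansion H"
    unfolding H_def
    by (intro has_fps_expansion_fps_compose deg_polyexp_has_fps_expansion lam
        fps_expansion_intros F) (simp add: F0)
  have "fps_nth H 0 = 0"
    by (simp add: H_def deg_polyexp_fps_def)
  then have "B 0 = 1 \<and> Abs_fps (\<lambda>n. if n = 0 then 0 else B n / fact n) = H \<longleftrightarrow>
      B = (\<lambda>n. if n = 0 then 1 else fact n * fps_nth H n)" for B
    by (auto simp: fps_eq_iff fun_eq_iff field_simps)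
  then show ?thesis
    unfolding prob_deg_bell_def has_fps_expansion_iff_eq[OF expansion] using m by (simp add: H_def)
qed

lemma prob_deg_bell_eq_sum_prob_deg_Stirling:
  assumes F: "expect_deg_exp M Y lam has_fps_expansion F" and F0: "fps_nth F 0 = 1"
    and lam: "lam \<noteq> 0" and m: "m > 0"
  shows "prob_deg_bell M Y k lam x m =
    (\<Sum>n=1..m. real n powi (1 - k) * deg_ffact lam 1 n * prob_deg_Stirling M Y lam m n * x ^ n)"
proof -
  let ?P = "deg_polyexp_fps k lam"
  have "prob_deg_bell M Y k lam x m = fact m * fps_nth (?P oo (fps_const x * (F - 1))) m"
    by (rule prob_deg_bell_eq_fps_nth[OF F F0 lam m])
  also have "\<dots> = (\<Sum>n=0..m. fact m * (fps_nth ?P n * (x ^ n * fps_nth ((F - 1) ^ n) m)))"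
    by (simp add: fps_compose_nth power_mult_distrib fps_const_power sum_distrib_left)
  also have "\<dots> = (\<Sum>n=1..m. fact m * (fps_nth ?P n * (x ^ n * fps_nth ((F - 1) ^ n) m)))"
    by (intro sum.mono_neutral_right) (auto simp: deg_polyexp_fps_def not_less_eq_eq)
  also have "\<dots> = (\<Sum>n=1..m. real n powi (1 - k) * deg_ffact lam 1 n *
      prob_deg_Stirling M Y lam m n * x ^ n)"
    by (intro sum.cong) (auto simp: deg_polyexp_fps_nth prob_deg_Stirling_eq_fps_nth[OF F F0])
  finally show ?thesis .
qed

theorem theorem2p1:
  fixes M :: "'a measure" and Y :: "'a \<Rightarrow> real" and lam :: real and m :: nat
  assumes "prob_space M"
    and "Y \<in> borel_measurable M"
    and "\<exists>r>0. \<forall>t. \<bar>t\<bar> < r \<longrightarrow> integrable M (\<lambda>\<omega>. exp (Y \<omega> * t))"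
    and "lam \<noteq> 0"
    and "m \<ge> 1"
  shows "(\<forall>x::real. prob_deg_bell M Y 1 lam x m =
            (\<Sum>n=1..m. deg_ffact lam 1 n * prob_deg_Stirling M Y lam m n * x ^ n)) \<and>
         prob_deg_bell_number M Y 1 lam m =
            (\<Sum>n=1..m. deg_ffact lam 1 n * prob_deg_Stirling M Y lam m n)"
proof -
  interpret prob_space M by fact
  have "prob_deg_bell M Y 1 lam x m =
      (\<Sum>n=1..m. deg_ffact lam 1 n * prob_deg_Stirling M Y lam m n * x ^ n)" for x
    using prob_deg_bell_eq_sum_prob_deg_Stirling[where k = 1, OF
        expect_deg_exp_has_fps_expansion[OF assms(2-4)] expect_deg_exp_fps_nth_0 assms(4)] assms(5)
    by simp
  then show ?thesis
    by (simp add: prob_deg_bell_number_def)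
qed

end
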